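(* Let $C_\ast\ge 0$ be a constant. For any real constants $C_1,C_3$ with $|C_1|\le C_\ast$ and any smooth function $C_2:(-\infty,0]\to\mathbb{R}$, the functions $$u^r=C_1 r,\qquad u^z=-2C_1 z+C_2(t),$$ $$p=-C_1^2\left(\tfrac12 r^2+2z^2\right)+\left(2C_1C_2(t)-C_2'(t)\right)z+C_3$$ give a solution $u=u^re_r+u^ze_z$, with pressure $p$, of the axially symmetric Navier–Stokes equations without swirl $$\begin{cases}\partial_t u^r+(u^r\partial_r+u^z\partial_z)u^r+\partial_r p=\left(\partial_r^2+\frac1r\partial_r+\partial_z^2-\frac1{r^2}\right)u^r,\\ \partial_t u^z+(u^r\partial_r+u^z\partial_z)u^z+\partial_z p=\left(\partial_r^2+\frac1r\partial_r+\partial_z^2\right)u^z,\\ \partial_r u^r+\frac{u^r}{r}+\partial_z u^z=0\end{cases}$$ in $(-\infty,0]\times\mathbb{R}^3$, and this solution satisfies $$|u^r(t,r,z)|+|u^z(t,r,z)-u^z(t,0,z)|\le C_\ast r\qquad\text{for all } t\le 0,\ r\ge 0,\ z\in\mathbb{R}.$$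
   Context: Cylindrical coordinates $(r,\theta,z)$ on $\mathbb{R}^3$ are given by $x=(x_1,x_2,x_3)=(r\cos\theta,r\sin\theta,z)$, with basis vectors $e_r=(x_1/r,x_2/r,0)$, $e_\theta=(-x_2/r,x_1/r,0)$, $e_z=(0,0,1)$. An axially symmetric vector field is $u=u^re_r+u^\theta e_\theta+u^ze_z$ with components depending only on $(t,r,z)$; it is without swirl if $u^\theta\equiv 0$. For such $u$ the incompressible Navier–Stokes equations $\partial_t u+u\cdot\nabla u+\nabla p-\Delta u=0$, $\nabla\cdot u=0$ take the cylindrical form given in the claim. *)

theory Defs
  imports "HOL-Analysis.Analysis"
begin

text \<open>
  The sets used below are \<open>{..0}\<close> and \<open>{..0} \<times> UNIV\<close>, closed and convex with
  nonempty interior, so derivatives within the set are unique and are one-sided in time at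
  \<open>t = 0\<close>. Values of \<open>f\<close> outside \<open>S\<close> are irrelevant.
\<close>

primrec Ck_on :: "nat \<Rightarrow> 'a::euclidean_space set \<Rightarrow> ('a \<Rightarrow> 'b::euclidean_space) \<Rightarrow> bool" where
  "Ck_on 0 S f \<longleftrightarrow> continuous_on S f"
| "Ck_on (Suc k) S f \<longleftrightarrow>
     (\<exists>f'. (\<forall>x\<in>S. (f has_derivative f' x) (at x within S)) \<and>
           (\<forall>v. Ck_on k S (\<lambda>x. f' x v)))"

definition smooth_on :: "'a::euclidean_space set \<Rightarrow> ('a \<Rightarrow> 'b::euclidean_space) \<Rightarrow> bool" where
  "smooth_on S f \<longleftrightarrow> (\<forall>k. Ck_on k S f)"

text \<open>
  The operators below are total; they are only applied to functions for which smoothness is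
  demanded separately, so that they denote genuine derivatives.
\<close>

definition dt :: "(real \<Rightarrow> 'b::real_normed_vector) \<Rightarrow> real \<Rightarrow> 'b" where
  "dt f t = vector_derivative f (at t within {..0})"

definition partial :: "3 \<Rightarrow> (real^3 \<Rightarrow> 'b::real_normed_vector) \<Rightarrow> real^3 \<Rightarrow> 'b" where
  "partial i f x = vector_derivative (\<lambda>s. f (x + s *\<^sub>R axis i 1)) (at 0)"

definition gradient :: "(real^3 \<Rightarrow> real) \<Rightarrow> real^3 \<Rightarrow> real^3" where
  "gradient f x = (\<chi> i. partial i f x)"

definition divergence :: "(real^3 \<Rightarrow> real^3) \<Rightarrow> real^3 \<Rightarrow> real" where
  "divergence v x = (\<Sum>i\<in>UNIV. partial i (\<lambda>y. v y $ i) x)"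

definition laplacian :: "(real^3 \<Rightarrow> 'b::real_normed_vector) \<Rightarrow> real^3 \<Rightarrow> 'b" where
  "laplacian f x = (\<Sum>i\<in>UNIV. partial i (partial i f) x)"

definition advection :: "(real^3 \<Rightarrow> real^3) \<Rightarrow> (real^3 \<Rightarrow> real^3) \<Rightarrow> real^3 \<Rightarrow> real^3" where
  "advection v w x = (\<Sum>i\<in>UNIV. (v x $ i) *\<^sub>R partial i w x)"

definition navier_stokes ::
  "(real \<Rightarrow> real^3 \<Rightarrow> real^3) \<Rightarrow> (real \<Rightarrow> real^3 \<Rightarrow> real) \<Rightarrow> bool" where
  "navier_stokes u p \<longleftrightarrow>
     (\<forall>t\<le>0. \<forall>x.
        dt (\<lambda>s. u s x) t + advection (u t) (u t) x + gradient (p t) x - laplacian (u t) x = 0 \<and>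
        divergence (u t) x = 0)"

text \<open>Functions of \<open>(t, r, z)\<close>; the equations carry \<open>1/r\<close>, hence the restriction \<open>r > 0\<close>.\<close>

definition axisymmetric_navier_stokes ::
  "(real \<Rightarrow> real \<Rightarrow> real \<Rightarrow> real) \<Rightarrow> (real \<Rightarrow> real \<Rightarrow> real \<Rightarrow> real) \<Rightarrow>
   (real \<Rightarrow> real \<Rightarrow> real \<Rightarrow> real) \<Rightarrow> bool" where
  "axisymmetric_navier_stokes ur uz p \<longleftrightarrow>
     (\<forall>t\<le>0. \<forall>r>0. \<forall>z.
        dt (\<lambda>s. ur s r z) t
          + (ur t r z * deriv (\<lambda>s. ur t s z) r + uz t r z * deriv (\<lambda>s. ur t r s) z)
          + deriv (\<lambda>s. p t s z) r
        = deriv (deriv (\<lambda>s. ur t s z)) r + 1 / r * deriv (\<lambda>s. ur t s z) r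
          + deriv (deriv (\<lambda>s. ur t r s)) z - 1 / r\<^sup>2 * ur t r z \<and>
        dt (\<lambda>s. uz s r z) t
          + (ur t r z * deriv (\<lambda>s. uz t s z) r + uz t r z * deriv (\<lambda>s. uz t r s) z)
          + deriv (\<lambda>s. p t r s) z
        = deriv (deriv (\<lambda>s. uz t s z)) r + 1 / r * deriv (\<lambda>s. uz t s z) r
          + deriv (deriv (\<lambda>s. uz t r s)) z \<and>
        deriv (\<lambda>s. ur t s z) r + ur t r z / r + deriv (\<lambda>s. uz t r s) z = 0)"

definition rad :: "real^3 \<Rightarrow> real" where
  "rad x = sqrt ((x $ 1)\<^sup>2 + (x $ 2)\<^sup>2)"

text \<open>On the axis, division by zero gives \<open>e_r x = 0\<close>, so \<open>ur\<close> does not contribute there.\<close>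

definition e_r :: "real^3 \<Rightarrow> real^3" where
  "e_r x = vector [x $ 1 / rad x, x $ 2 / rad x, 0]"

definition e_z :: "real^3" where
  "e_z = vector [0, 0, 1]"

definition swirl_free_field ::
  "(real \<Rightarrow> real \<Rightarrow> real \<Rightarrow> real) \<Rightarrow> (real \<Rightarrow> real \<Rightarrow> real \<Rightarrow> real) \<Rightarrow> real \<Rightarrow> real^3 \<Rightarrow> real^3" where
  "swirl_free_field ur uz t x =
     ur t (rad x) (x $ 3) *\<^sub>R e_r x + uz t (rad x) (x $ 3) *\<^sub>R e_z"

definition axisymmetric_scalar ::
  "(real \<Rightarrow> real \<Rightarrow> real \<Rightarrow> real) \<Rightarrow> real \<Rightarrow> real^3 \<Rightarrow> real" where
  "axisymmetric_scalar p t x = p t (rad x) (x $ 3)"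

text \<open>
  A classical solution in \<open>(-\<infinity>, 0] \<times> \<real>\<^sup>3\<close>. The cylindrical system makes sense only off the
  axis; the Cartesian system gives the meaning of the equations on the axis as well. Smoothness
  of the Cartesian fields implies smoothness of \<open>ur\<close>, \<open>uz\<close>, \<open>p\<close> in \<open>(t, r, z)\<close> for \<open>r > 0\<close>.
\<close>

definition axisymmetric_swirl_free_solution ::
  "(real \<Rightarrow> real \<Rightarrow> real \<Rightarrow> real) \<Rightarrow> (real \<Rightarrow> real \<Rightarrow> real \<Rightarrow> real) \<Rightarrow>
   (real \<Rightarrow> real \<Rightarrow> real \<Rightarrow> real) \<Rightarrow> bool" where
  "axisymmetric_swirl_free_solution ur uz p \<longleftrightarrow>
     smooth_on ({..0} \<times> UNIV) (\<lambda>(t, x). swirl_free_field ur uz t x) \<and>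
     smooth_on ({..0} \<times> UNIV) (\<lambda>(t, x). axisymmetric_scalar p t x) \<and>
     axisymmetric_navier_stokes ur uz p \<and>
     navier_stokes (swirl_free_field ur uz) (axisymmetric_scalar p)"

end

theory Submission
  imports Defs
begin

text \<open>
  In Cartesian coordinates the field is affine in space, \<open>u = L x + C2(t) e_z\<close> with
  \<open>L = diag(C1, C1, -2 C1)\<close> trace free. Hence the viscous term vanishes and the nonlinear term
  \<open>L (L x + C2(t) e_z)\<close>, together with \<open>C2'(t) e_z\<close>, is the gradient of the quadratic polynomial
  \<open>-p\<close>. The factor \<open>rad x\<close> in \<open>u\<^sup>r = C1 * rad x\<close> cancels the one in \<open>e_r x\<close>, and \<open>p\<close> depends on
  \<open>rad x\<close> only through its square, so both fields are smooth across the axis.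
\<close>

section \<open>Closure properties of C^k functions on a set\<close>

lemma Ck_on_cong:
  assumes "\<And>x. x \<in> S \<Longrightarrow> f x = g x"
  shows "Ck_on k S f \<longleftrightarrow> Ck_on k S g"
proof (cases k)
  case 0
  then show ?thesis using continuous_on_cong[OF refl assms] by simp
next
  case (Suc m)
  have "(f has_derivative D) (at x within S) \<longleftrightarrow> (g has_derivative D) (at x within S)"
    if "x \<in> S" for x D
    using has_derivative_transform[of x S f g D] has_derivative_transform[of x S g f D] assms that
    by metis
  then show ?thesis by (auto simp: Suc)
qed

text \<open>The same derivative \<open>f'\<close> serves as witness, its directional derivatives
  losing one order by induction; at order 0, differentiability gives continuity. The product rule
  needs this, since its terms contain undifferentiated factors.\<close>

lemma Ck_on_Suc_imp_Ck_on: "Ck_on (Suc k) S f \<Longrightarrow> Ck_on k S f"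
proof (induction k arbitrary: f)
  case 0
  then show ?case
    unfolding Ck_on.simps continuous_on_eq_continuous_within
    using has_derivative_continuous by blast
next
  case (Suc k)
  then obtain f' where f': "\<forall>x\<in>S. (f has_derivative f' x) (at x within S)"
    "\<forall>v. Ck_on (Suc k) S (\<lambda>x. f' x v)"
    by (auto simp only: Ck_on.simps(2)[of "Suc k"])
  have "Ck_on k S (\<lambda>x. f' x v)" for v
    by (rule Suc.IH) (rule f'(2)[rule_format])
  with f'(1) show ?case
    unfolding Ck_on.simps(2) by (intro exI[of _ f']) simp
qed

lemma Ck_on_const: "Ck_on k S (\<lambda>x. c)"
proof (induction k arbitrary: c)
  case (Suc k)
  then show ?case
    by (auto intro!: exI[of _ "\<lambda>_ _. 0"])
qed simp

text \<open>The derivative is \<open>f\<close> itself at every point, so each directional derivative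
  is constant.\<close>

lemma Ck_on_bounded_linear:
  assumes "bounded_linear f"
  shows "Ck_on k S f"
proof (cases k)
  case 0
  then show ?thesis using assms by (simp add: linear_continuous_on)
next
  case (Suc m)
  have "\<forall>x\<in>S. (f has_derivative f) (at x within S)"
    using assms bounded_linear_imp_has_derivative by blast
  then show ?thesis
    unfolding Suc Ck_on.simps(2) by (intro exI[of _ "\<lambda>_. f"] conjI allI Ck_on_const)
qed

lemma Ck_on_add:
  assumes "Ck_on k S f" "Ck_on k S g"
  shows "Ck_on k S (\<lambda>x. f x + g x)"
  using assms
proof (induction k arbitrary: f g)
  case 0
  then show ?case by (simp add: continuous_on_add)
next
  case (Suc k)
  obtain f' where f': "\<forall>x\<in>S. (f has_derivative f' x) (at x within S)" "\<forall>v. Ck_on k S (\<lambda>x. f' x v)"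
    using Suc.prems(1) by auto
  obtain g' where g': "\<forall>x\<in>S. (g has_derivative g' x) (at x within S)" "\<forall>v. Ck_on k S (\<lambda>x. g' x v)"
    using Suc.prems(2) by auto
  show ?case
    using f' g' Suc.IH
    by (auto intro!: exI[of _ "\<lambda>x v. f' x v + g' x v"] has_derivative_add)
qed

lemma Ck_on_scaleR:
  assumes "Ck_on k S f" "Ck_on k S g"
  shows "Ck_on k S (\<lambda>x. f x *\<^sub>R g x)"
  using assms
proof (induction k arbitrary: f g)
  case 0
  then show ?case by (simp add: continuous_on_scaleR)
next
  case (Suc k)
  obtain f' where f': "\<forall>x\<in>S. (f has_derivative f' x) (at x within S)" "\<forall>v. Ck_on k S (\<lambda>x. f' x v)"
    using Suc.prems(1) by auto
  obtain g' where g': "\<forall>x\<in>S. (g has_derivative g' x) (at x within S)" "\<forall>v. Ck_on k S (\<lambda>x. g' x v)"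
    using Suc.prems(2) by auto
  \<comment> \<open>Here \<open>f\<close> and \<open>g\<close> are C^(k+1) while their derivatives
    are only C^k, so both are lowered to order \<open>k\<close> before the induction hypothesis
    applies.\<close>
  have "Ck_on k S (\<lambda>x. f x *\<^sub>R g' x v + f' x v *\<^sub>R g x)" for v
    using f' g' Suc.prems[THEN Ck_on_Suc_imp_Ck_on] by (intro Ck_on_add Suc.IH) auto
  then show ?case
    using f' g'
    by (auto intro!: exI[of _ "\<lambda>x v. f x *\<^sub>R g' x v + f' x v *\<^sub>R g x"] has_derivative_scaleR)
qed

lemma Ck_on_mult:
  fixes f g :: "'a::euclidean_space \<Rightarrow> real"
  assumes "Ck_on k S f" "Ck_on k S g"
  shows "Ck_on k S (\<lambda>x. f x * g x)"
  using Ck_on_scaleR[OF assms] by simp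

text \<open>For linear \<open>L\<close> the derivative in direction \<open>v\<close> is
  \<open>f' (L x) (L v)\<close>: the directional derivative of \<open>f\<close> in the fixed
  direction \<open>L v\<close>, again composed with \<open>L\<close>. The induction thus closes
  without products.\<close>

lemma Ck_on_compose_bounded_linear:
  assumes "Ck_on k T f" "bounded_linear L" "L ` S \<subseteq> T"
  shows "Ck_on k S (\<lambda>x. f (L x))"
  using assms(1)
proof (induction k arbitrary: f)
  case 0
  then show ?case
    using assms(2,3) by (auto intro: continuous_on_compose2 linear_continuous_on)
next
  case (Suc k)
  then obtain f' where f': "\<forall>x\<in>T. (f has_derivative f' x) (at x within T)"
    "\<forall>v. Ck_on k T (\<lambda>x. f' x v)"
    by auto
  have "((\<lambda>x. f (L x)) has_derivative (\<lambda>v. f' (L x) (L v))) (at x within S)" if "x \<in> S" for x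
  proof -
    have "(f has_derivative f' (L x)) (at (L x) within L ` S)"
      using f'(1) assms(3) that by (blast intro: has_derivative_subset)
    then show ?thesis
      by (rule has_derivative_in_compose[OF bounded_linear_imp_has_derivative[OF assms(2)]])
  qed
  moreover have "Ck_on k S (\<lambda>x. f' (L x) (L v))" for v
    using Suc.IH[of "\<lambda>x. f' x (L v)"] f'(2) by blast
  ultimately show ?case
    by (auto intro!: exI[of _ "\<lambda>x v. f' (L x) (L v)"])
qed

lemma Ck_on_fst:
  assumes "Ck_on k T f"
  shows "Ck_on k (T \<times> S) (\<lambda>p. f (fst p))"
  by (rule Ck_on_compose_bounded_linear[OF assms bounded_linear_fst]) auto

section \<open>One-sided time derivatives\<close>

lemma dt_eq:
  assumes "(f has_vector_derivative D) (at t within {..0})" "t \<le> 0"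
  shows "dt f t = D"
proof -
  \<comment> \<open>Uniqueness of the derivative, including at t = 0, where only the past is
    available: the interval from t - 1 to t lies in the domain.\<close>
  have "t islimpt {..0::real}"
    using assms(2) islimpt_subset[of t "{t - 1..t}" "{..0}"] by simp
  then show ?thesis
    unfolding dt_def using assms(1)
    by (simp add: vector_derivative_within trivial_limit_within)
qed

lemma has_derivative_imp_dt:
  assumes "(f has_derivative D) (at t within {..0})" "t \<le> 0"
  shows "dt f t = D 1"
    and "(f has_vector_derivative dt f t) (at t within {..0})"
proof -
  have "D v = v *\<^sub>R D 1" for v
    using linear_scale[OF has_derivative_linear[OF assms(1)], of v 1] by simp
  then have "D = (\<lambda>v. v *\<^sub>R D 1)"
    by (rule ext)
  then have D: "(f has_vector_derivative D 1) (at t within {..0})"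
    using assms(1) unfolding has_vector_derivative_def by metis
  then show "dt f t = D 1"
    by (rule dt_eq) fact
  with D show "(f has_vector_derivative dt f t) (at t within {..0})"
    by simp
qed

text \<open>The pressure contains C2', so its smoothness requires that of \<open>dt C2\<close>. The
  derivative in direction 1 agrees with \<open>dt f\<close> on the half-line, which is all that
  \<open>Ck_on_cong\<close> asks.\<close>

lemma Ck_on_dt:
  assumes "Ck_on (Suc k) {..0} f"
  shows "Ck_on k {..0} (dt f)"
proof -
  obtain f' where f': "\<forall>x\<in>{..0}. (f has_derivative f' x) (at x within {..0})"
    "Ck_on k {..0} (\<lambda>x. f' x 1)"
    using assms by auto
  moreover have "dt f x = f' x 1" if "x \<in> {..0}" for x
    using f'(1) that by (intro has_derivative_imp_dt(1)) auto
  ultimately show ?thesis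
    using Ck_on_cong[of "{..0}" "dt f" "\<lambda>x. f' x 1"] by simp
qed

lemma Ck_on_has_dt:
  assumes "Ck_on (Suc k) {..0} f" "t \<le> 0"
  shows "(f has_vector_derivative dt f t) (at t within {..0})"
proof -
  obtain f' where "\<forall>x\<in>{..0}. (f has_derivative f' x) (at x within {..0})"
    using assms(1) by auto
  with assms(2) show ?thesis
    by (intro has_derivative_imp_dt(2)) auto
qed

section \<open>Spatial operators on affine fields\<close>

lemma partial_eq:
  assumes "(f has_derivative D) (at x)"
  shows "partial i f x = D (axis i 1)"
proof -
  have "((\<lambda>s. x + s *\<^sub>R axis i 1) has_vector_derivative axis i 1) (at (0::real))"
    by (auto intro!: derivative_eq_intros)
  then have "((f \<circ> (\<lambda>s. x + s *\<^sub>R axis i 1)) has_vector_derivative D (axis i 1)) (at 0)"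
    by (rule vector_derivative_diff_chain_within) (use assms in \<open>auto intro: has_derivative_at_withinI\<close>)
  then show ?thesis
    unfolding partial_def by (simp add: o_def vector_derivative_at)
qed

text \<open>Equality of functions rather than of values, so that the inner derivative in
  \<open>laplacian\<close> can be rewritten to a constant.\<close>

lemma partial_affine:
  assumes "bounded_linear L"
  shows "partial i (\<lambda>x. L x + c) = (\<lambda>x. L (axis i 1))"
  using assms
  by (auto intro!: partial_eq derivative_eq_intros bounded_linear_imp_has_derivative)

lemma partial_const: "partial i (\<lambda>x. c) = (\<lambda>x. 0)"
  by (auto intro!: partial_eq)

lemma laplacian_affine:
  assumes "bounded_linear L"
  shows "laplacian (\<lambda>x. L x + c) x = 0"
  unfolding laplacian_def partial_affine[OF assms] partial_const by simp

text \<open>Expanding \<open>v x\<close> in the standard basis turns the sum over partial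
  derivatives into the linear map \<open>L\<close> applied to \<open>v x\<close>.\<close>

lemma advection_affine:
  assumes "bounded_linear L"
  shows "advection v (\<lambda>x. L x + c) x = L (v x)"
proof -
  have "L (v x) = L (\<Sum>i\<in>UNIV. (v x $ i) *\<^sub>R axis i 1)"
    using basis_expansion[of "v x"] by (simp add: scalar_mult_eq_scaleR)
  also have "\<dots> = advection v (\<lambda>x. L x + c) x"
    unfolding advection_def partial_affine[OF assms]
    using bounded_linear.linear[OF assms] by (simp add: linear_sum linear_scale)
  finally show ?thesis ..
qed

section \<open>Velocity and pressure in Cartesian coordinates; \<open>strain a\<close> is the map L
  with C1 = a\<close>

definition strain :: "real \<Rightarrow> real^3 \<Rightarrow> real^3" where
  "strain a x = vector [a * x $ 1, a * x $ 2, - 2 * a * x $ 3]"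

lemma bounded_linear_strain: "bounded_linear (strain a)"
  unfolding linear_conv_bounded_linear[symmetric]
  by (rule linearI) (auto simp: strain_def vec_eq_iff forall_3 algebra_simps)

lemma swirl_free_field_eq:
  "swirl_free_field (\<lambda>t r z. a * r) (\<lambda>t r z. - 2 * a * z + c t) t x = strain a x + c t *\<^sub>R e_z"
proof (cases "rad x = 0")
  \<comment> \<open>No cancellation of \<open>rad x\<close> on the axis; instead x1 = x2 = 0 makes
    the horizontal components of both sides 0.\<close>
  case True
  then have "x $ 1 = 0" "x $ 2 = 0"
    by (auto simp: rad_def sum_power2_eq_zero_iff)
  with True show ?thesis
    by (simp add: swirl_free_field_def strain_def e_r_def e_z_def vec_eq_iff forall_3)
next
  case False
  then show ?thesis
    by (simp add: swirl_free_field_def strain_def e_r_def e_z_def vec_eq_iff forall_3)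
qed

text \<open>Squares become products so that \<open>Ck_on_mult\<close> applies directly.\<close>

lemma axisymmetric_scalar_quadratic_eq:
  "axisymmetric_scalar (\<lambda>t r z. - a\<^sup>2 * (1 / 2 * r\<^sup>2 + 2 * z\<^sup>2) + h t * z + b) t x =
     - a\<^sup>2 * (1 / 2 * (x $ 1 * x $ 1 + x $ 2 * x $ 2) + 2 * (x $ 3 * x $ 3)) + h t * x $ 3 + b"
  by (simp add: axisymmetric_scalar_def rad_def power2_eq_square)

lemma bounded_linear_snd_nth: "bounded_linear (\<lambda>p. snd p $ i)"
  by (rule bounded_linear_compose[OF bounded_linear_vec_nth bounded_linear_snd])

section \<open>Smoothness across the axis\<close>

lemma smooth_on_strain_field:
  fixes c :: "real \<Rightarrow> real"
  assumes "smooth_on {..0} c"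
  shows "smooth_on ({..0} \<times> UNIV) (\<lambda>(t, x). strain a x + c t *\<^sub>R e_z)"
  unfolding smooth_on_def case_prod_beta
proof
  fix k
  have "Ck_on k ({..0} \<times> UNIV) (\<lambda>p. c (fst p))"
    using assms Ck_on_fst unfolding smooth_on_def by blast
  then show "Ck_on k ({..0} \<times> UNIV) (\<lambda>p. strain a (snd p) + c (fst p) *\<^sub>R e_z)"
    by (intro Ck_on_add Ck_on_scaleR Ck_on_const
        Ck_on_bounded_linear[OF bounded_linear_compose[OF bounded_linear_strain bounded_linear_snd]])
qed

lemma smooth_on_quadratic_pressure:
  fixes h :: "real \<Rightarrow> real"
  assumes "smooth_on {..0} h"
  shows "smooth_on ({..0} \<times> UNIV)
    (\<lambda>(t, x::real^3). a * (1 / 2 * (x $ 1 * x $ 1 + x $ 2 * x $ 2) + 2 * (x $ 3 * x $ 3))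
       + h t * x $ 3 + b)"
  unfolding smooth_on_def case_prod_beta
proof
  fix k
  let ?S = "{..0::real} \<times> (UNIV :: (real^3) set)"
  have "Ck_on k ?S (\<lambda>p. h (fst p))"
    using assms Ck_on_fst unfolding smooth_on_def by blast
  moreover have "Ck_on k ?S (\<lambda>p. snd p $ i)" for i
    by (rule Ck_on_bounded_linear[OF bounded_linear_snd_nth])
  ultimately show "Ck_on k ?S (\<lambda>p. a * (1 / 2 * (snd p $ 1 * snd p $ 1 + snd p $ 2 * snd p $ 2)
      + 2 * (snd p $ 3 * snd p $ 3)) + h (fst p) * snd p $ 3 + b)"
    by (intro Ck_on_add Ck_on_mult Ck_on_const)
qed

section \<open>The Cartesian and cylindrical equations\<close>

lemma gradient_quadratic_pressure:
  "gradient (\<lambda>x. - a\<^sup>2 * (1 / 2 * (x $ 1 * x $ 1 + x $ 2 * x $ 2) + 2 * (x $ 3 * x $ 3)) + h * x $ 3 + b) x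
   = vector [- a\<^sup>2 * x $ 1, - a\<^sup>2 * x $ 2, - 4 * a\<^sup>2 * x $ 3 + h]"
proof -
  let ?q = "\<lambda>x::real^3. - a\<^sup>2 * (1 / 2 * (x $ 1 * x $ 1 + x $ 2 * x $ 2) + 2 * (x $ 3 * x $ 3)) + h * x $ 3 + b"
  \<comment> \<open>Evaluating this one derivative at \<open>axis i 1\<close> gives all three
    partial derivatives.\<close>
  have "(?q has_derivative (\<lambda>v. - a\<^sup>2 * (x $ 1 * v $ 1 + x $ 2 * v $ 2 + 4 * (x $ 3 * v $ 3)) + h * v $ 3)) (at x)"
    by (rule derivative_eq_intros bounded_linear_imp_has_derivative[OF bounded_linear_vec_nth] refl)+
      (simp add: fun_eq_iff algebra_simps)
  from partial_eq[OF this] show ?thesis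
    by (simp add: gradient_def vec_eq_iff forall_3 axis_def)
qed

text \<open>The divergence is the trace a + a - 2a.\<close>

lemma divergence_strain_field: "divergence (\<lambda>x. strain a x + c) x = 0"
proof -
  have "partial i (\<lambda>y. strain a y $ i + c $ i) = (\<lambda>x. strain a (axis i 1) $ i)" for i
    by (rule partial_affine)
      (rule bounded_linear_compose[OF bounded_linear_vec_nth bounded_linear_strain])
  then show ?thesis
    by (simp add: divergence_def sum_3 strain_def axis_def)
qed

text \<open>Used with \<open>v = e_z\<close> for the Cartesian field and with \<open>v = 1\<close>
  for the scalar \<open>uz\<close>.\<close>

lemma dt_add_scaleR:
  assumes "(c has_vector_derivative dt c t) (at t within {..0})" "t \<le> 0"
  shows "dt (\<lambda>s. w + c s *\<^sub>R v) t = dt c t *\<^sub>R v"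
  using assms
  by (intro dt_eq)
    (auto intro!: derivative_eq_intros simp: has_real_derivative_iff_has_vector_derivative)

lemma navier_stokes_strain_field:
  assumes "\<And>t. t \<le> 0 \<Longrightarrow> (c has_vector_derivative dt c t) (at t within {..0})"
  shows "navier_stokes (\<lambda>t x. strain a x + c t *\<^sub>R e_z)
    (\<lambda>t x. - a\<^sup>2 * (1 / 2 * (x $ 1 * x $ 1 + x $ 2 * x $ 2) + 2 * (x $ 3 * x $ 3))
       + (2 * a * c t - dt c t) * x $ 3 + b)"
  unfolding navier_stokes_def gradient_quadratic_pressure divergence_strain_field
    advection_affine[OF bounded_linear_strain] laplacian_affine[OF bounded_linear_strain]
proof (intro allI impI conjI refl)
  fix t :: real and x
  assume t: "t \<le> 0"
  show "dt (\<lambda>s. strain a x + c s *\<^sub>R e_z) t + strain a (strain a x + c t *\<^sub>R e_z)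
    + vector [- a\<^sup>2 * x $ 1, - a\<^sup>2 * x $ 2, - 4 * a\<^sup>2 * x $ 3 + (2 * a * c t - dt c t)] - 0 = 0"
    unfolding dt_add_scaleR[OF assms[OF t] t]
    \<comment> \<open>The advection term is (a^2 x1, a^2 x2, 4 a^2 x3 - 2 a c). The coefficient 2 a
      c - c' in the pressure cancels the leftover -2 a c together with the c' of the time
      derivative.\<close>
    by (simp add: strain_def e_z_def vec_eq_iff forall_3 power2_eq_square algebra_simps)
qed

lemma axisymmetric_navier_stokes_linear:
  assumes "\<And>t. t \<le> 0 \<Longrightarrow> (c has_vector_derivative dt c t) (at t within {..0})"
  shows "axisymmetric_navier_stokes (\<lambda>t r z. a * r) (\<lambda>t r z. - 2 * a * z + c t)
    (\<lambda>t r z. - a\<^sup>2 * (1 / 2 * r\<^sup>2 + 2 * z\<^sup>2) + (2 * a * c t - dt c t) * z + b)"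
proof -
  have dt0: "dt (\<lambda>s. a * r) t = 0" if "t \<le> 0" for r t
    using that by (intro dt_eq) auto
  have dtc: "dt (\<lambda>s. - 2 * a * z + c s) t = dt c t" if "t \<le> 0" for z t
    using dt_add_scaleR[OF assms[OF that] that, of "- 2 * a * z" 1] by simp
  \<comment> \<open>Equalities of functions again, for use under the second
    \<open>deriv\<close>.\<close>
  have d: "deriv (\<lambda>s. m * s + k) = (\<lambda>_. m)" for m k :: real
    by (auto intro!: ext DERIV_imp_deriv derivative_eq_intros)
  have d': "deriv (\<lambda>s. m * s) = (\<lambda>_. m)" for m :: real
    using d[of m 0] by simp
  have pr: "deriv (\<lambda>s. - a\<^sup>2 * (1 / 2 * s\<^sup>2 + 2 * z\<^sup>2) + h * z + b) r = - a\<^sup>2 * r" for h r z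
    by (auto intro!: DERIV_imp_deriv derivative_eq_intros)
  have pz: "deriv (\<lambda>s. - a\<^sup>2 * (1 / 2 * r\<^sup>2 + 2 * s\<^sup>2) + h * s + b) z = - 4 * a\<^sup>2 * z + h" for h r z
    by (auto intro!: DERIV_imp_deriv derivative_eq_intros)
  show ?thesis
    unfolding axisymmetric_navier_stokes_def pr pz d d' deriv_const
  proof (intro allI impI, goal_cases)
    case (1 t r z)
    then show ?case
      \<comment> \<open>In the radial equation a^2 r cancels against the pressure, and the viscous
        terms a / r and - a r / r^2 cancel each other.\<close>
      unfolding dt0[OF 1(1)] dtc[OF 1(1)] by (simp add: power2_eq_square field_simps)
  qed
qed

theorem proposition1p5:
  fixes Cstar C1 C3 :: real
    and C2 :: "real \<Rightarrow> real"
    and ur uz p :: "real \<Rightarrow> real \<Rightarrow> real \<Rightarrow> real"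
  assumes "Cstar \<ge> 0"
    and "\<bar>C1\<bar> \<le> Cstar"
    and "smooth_on {..0} C2"
    and "ur = (\<lambda>t r z. C1 * r)"
    and "uz = (\<lambda>t r z. - 2 * C1 * z + C2 t)"
    and "p = (\<lambda>t r z. - C1\<^sup>2 * (1 / 2 * r\<^sup>2 + 2 * z\<^sup>2) + (2 * C1 * C2 t - dt C2 t) * z + C3)"
  shows "axisymmetric_swirl_free_solution ur uz p \<and>
         (\<forall>t\<le>0. \<forall>r\<ge>0. \<forall>z. \<bar>ur t r z\<bar> + \<bar>uz t r z - uz t 0 z\<bar> \<le> Cstar * r)"
proof -
  have C2: "Ck_on k {..0} C2" for k
    using assms(3) unfolding smooth_on_def by blast
  have deriv_C2: "(C2 has_vector_derivative dt C2 t) (at t within {..0})" if "t \<le> 0" for t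
    using Ck_on_has_dt[OF C2 that] .
  \<comment> \<open>The difference is written as a sum with a multiple by -1 to fit the closure
    rules.\<close>
  have "Ck_on k {..0} (\<lambda>t. 2 * C1 * C2 t + (- 1) * dt C2 t)" for k
    by (intro Ck_on_add Ck_on_mult Ck_on_const C2 Ck_on_dt)
  then have h: "smooth_on {..0} (\<lambda>t. 2 * C1 * C2 t - dt C2 t)"
    by (simp add: smooth_on_def)
  have u_eq: "swirl_free_field ur uz = (\<lambda>t x. strain C1 x + C2 t *\<^sub>R e_z)"
    unfolding assms(4,5) by (intro ext swirl_free_field_eq)
  have p_eq: "axisymmetric_scalar p = (\<lambda>t x.
      - C1\<^sup>2 * (1 / 2 * (x $ 1 * x $ 1 + x $ 2 * x $ 2) + 2 * (x $ 3 * x $ 3))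
       + (2 * C1 * C2 t - dt C2 t) * x $ 3 + C3)"
    unfolding assms(6) by (intro ext axisymmetric_scalar_quadratic_eq)
  have "axisymmetric_swirl_free_solution ur uz p"
    unfolding axisymmetric_swirl_free_solution_def u_eq p_eq
    using smooth_on_strain_field[OF assms(3)] smooth_on_quadratic_pressure[OF h]
      navier_stokes_strain_field[OF deriv_C2] axisymmetric_navier_stokes_linear[OF deriv_C2]
    unfolding assms(4-6) by blast
  \<comment> \<open>Since \<open>uz\<close> does not depend on r, the second term vanishes and the
    first is |C1| r.\<close>
  moreover have "\<bar>ur t r z\<bar> + \<bar>uz t r z - uz t 0 z\<bar> \<le> Cstar * r" if "r \<ge> 0" for t r z
    using mult_right_mono[OF assms(2) that] that by (simp add: assms(4,5) abs_mult)
  ultimately show ?thesis by blast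
qed

end
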